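(* Let $n \ge 24$ be an even integer and let $\mathcal{H}=(V,\mathcal{E})$ be a 6-uniform hypergraph with $EI(\mathcal{H}) = C_n$. Then $|\mathcal{E}| \ge \frac{n}{2}$.
   Context: A hypergraph $\mathcal{H}=(V,\mathcal{E})$ consists of a finite vertex set $V$ and a set $\mathcal{E}$ of hyperedges, which are subsets of $V$; isolated vertices are allowed, but there are no multiple hyperedges and no loops (hyperedges with only one vertex). $\mathcal{H}$ is $k$-uniform if every hyperedge has cardinality $k$. The edge intersection hypergraph of $\mathcal{H}$ is $EI(\mathcal{H})=(V,\mathcal{E}^{EI})$, with the same vertex set $V$ and edge set $\mathcal{E}^{EI}=\{e_1\cap e_2 \mid e_1,e_2\in\mathcal{E},\ e_1\neq e_2,\ |e_1\cap e_2|\ge 2\}$. $C_n$ denotes the cycle with $n$ vertices, i.e. the graph with vertex set $V=\{1,2,\ldots,n\}$ and edge set $\{\{1,2\},\{2,3\},\ldots,\{n-1,n\},\{n,1\}\}$, regarded as a 2-uniform hypergraph. The equality $EI(\mathcal{H})=C_n$ means that $V=\{1,\ldots,n\}$ (up to labelling of the vertices) and $\mathcal{E}^{EI}=E(C_n)$. *)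

theory Defs
  imports Complex_Main
begin

record 'a hypergraph =
  verts :: "'a set"
  hyperedges :: "'a set set"

text \<open>Loops are hyperedges with exactly one vertex; multiple hyperedges are ruled out because
  the hyperedges form a set, and isolated vertices are allowed.\<close>

definition is_hypergraph :: "'a hypergraph \<Rightarrow> bool" where
  "is_hypergraph H \<longleftrightarrow>
     finite (verts H) \<and> (\<forall>e\<in>hyperedges H. e \<subseteq> verts H \<and> card e \<noteq> 1)"

definition uniform :: "nat \<Rightarrow> 'a hypergraph \<Rightarrow> bool" where
  "uniform k H \<longleftrightarrow> (\<forall>e\<in>hyperedges H. card e = k)"

definition EI :: "'a hypergraph \<Rightarrow> 'a hypergraph" where
  "EI H = \<lparr>verts = verts H,
           hyperedges = {e1 \<inter> e2 | e1 e2. e1 \<in> hyperedges H \<and> e2 \<in> hyperedges H \<and>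
                                        e1 \<noteq> e2 \<and> card (e1 \<inter> e2) \<ge> 2}\<rparr>"

definition cycle_hypergraph :: "nat \<Rightarrow> nat hypergraph" where
  "cycle_hypergraph n = \<lparr>verts = {1..n},
                         hyperedges = {{i, i + 1} | i. 1 \<le> i \<and> i < n} \<union> {{n, 1}}\<rparr>"

text \<open>Equality up to a labelling of the vertices.\<close>

definition hypergraph_iso :: "'a hypergraph \<Rightarrow> 'b hypergraph \<Rightarrow> bool" where
  "hypergraph_iso G H \<longleftrightarrow>
     (\<exists>f. bij_betw f (verts G) (verts H) \<and> (\<lambda>e. f ` e) ` hyperedges G = hyperedges H)"

end

theory Submission
  imports Defs
begin

text \<open>The bound comes from vertex degrees. A vertex \<open>v\<close> of the cycle lies on two different
  cycle edges, each of which is the intersection of two hyperedges through \<open>v\<close>. A pair of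
  hyperedges has only one intersection, so two hyperedges through \<open>v\<close> cannot produce both cycle
  edges, and \<open>v\<close> lies in at least three hyperedges
  (\<open>three_hyperedges_through_vertex\<close>). Counting incidences between vertices and
  hyperedges then gives \<open>3 n \<le> 6 \<bar>\<E>\<bar>\<close>
  (\<open>uniform_degree_bound\<close>), which is the claim.\<close>

lemma finite_hyperedges:
  assumes "is_hypergraph H"
  shows "finite (hyperedges H)"
proof (rule finite_subset)
  show "hyperedges H \<subseteq> Pow (verts H)" and "finite (Pow (verts H))"
    using assms by (auto simp: is_hypergraph_def)
qed

lemma EI_hyperedge_subset_verts:
  assumes "is_hypergraph H" "g \<in> hyperedges (EI H)"
  shows "g \<subseteq> verts H"
  using assms by (auto simp: is_hypergraph_def EI_def)

text \<open>If only two hyperedges passed through \<open>v\<close>, every edge of the edge intersection hypergraph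
  through \<open>v\<close> would be their intersection.\<close>

lemma three_hyperedges_through_vertex:
  assumes fin: "finite (hyperedges H)"
    and g: "g1 \<in> hyperedges (EI H)" "g2 \<in> hyperedges (EI H)" "g1 \<noteq> g2"
    and v: "v \<in> g1" "v \<in> g2"
  shows "3 \<le> card {e \<in> hyperedges H. v \<in> e}"
proof -
  let ?D = "{e \<in> hyperedges H. v \<in> e}"
  obtain a b where ab: "a \<in> ?D" "b \<in> ?D" "a \<noteq> b" "g1 = a \<inter> b"
    using g(1) v(1) by (auto simp: EI_def)
  obtain c d where cd: "c \<in> ?D" "d \<in> ?D" "c \<noteq> d" "g2 = c \<inter> d"
    using g(2) v(2) by (auto simp: EI_def)
  have "\<not> {c, d} \<subseteq> {a, b}"
    using ab cd g(3) by auto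
  then obtain x where x: "x \<in> ?D" "x \<noteq> a" "x \<noteq> b"
    using cd by blast
  have "card {a, b, x} \<le> card ?D"
    using ab x fin by (intro card_mono) auto
  then show ?thesis
    using ab(3) x(2,3) by simp
qed

lemma uniform_degree_bound:
  assumes H: "is_hypergraph H" and unif: "uniform k H"
    and deg: "\<And>v. v \<in> verts H \<Longrightarrow> d \<le> card {e \<in> hyperedges H. v \<in> e}"
  shows "d * card (verts H) \<le> k * card (hyperedges H)"
proof -
  have fin: "finite (verts H)" "finite (hyperedges H)"
    using H finite_hyperedges by (auto simp: is_hypergraph_def)
  have size: "card {v \<in> verts H. v \<in> e} = k" if "e \<in> hyperedges H" for e
  proof -
    have "{v \<in> verts H. v \<in> e} = e"
      using H that by (auto simp: is_hypergraph_def)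
    then show ?thesis
      using unif that by (simp add: uniform_def)
  qed
  have "d * card (verts H) \<le> (\<Sum>v\<in>verts H. card {e \<in> hyperedges H. v \<in> e})"
    using sum_mono[of "verts H" "\<lambda>_. d"] deg by (simp add: mult.commute)
  also have "\<dots> = k * card (hyperedges H)"
    using size fin by (intro sum_multicount) auto
  finally show ?thesis .
qed

lemma cycle_two_edges_at_vertex:
  assumes "3 \<le> n" "i \<in> {1..n}"
  obtains g1 g2 where "g1 \<in> hyperedges (cycle_hypergraph n)" "g2 \<in> hyperedges (cycle_hypergraph n)"
    "g1 \<noteq> g2" "i \<in> g1" "i \<in> g2"
proof -
  have step: "{j, j + 1} \<in> hyperedges (cycle_hypergraph n)" if "1 \<le> j" "j < n" for j
    using that by (auto simp: cycle_hypergraph_def)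
  have closing: "{n, 1} \<in> hyperedges (cycle_hypergraph n)"
    by (simp add: cycle_hypergraph_def)
  consider "i = 1" | "i = n" | "1 < i" "i < n"
    using assms(2) by force
  then show ?thesis
  proof cases
    case 1
    show ?thesis
      using that[OF step[of 1] closing] assms(1) 1 by (auto simp: doubleton_eq_iff)
  next
    case 2
    show ?thesis
      using that[OF step[of "n - 1"] closing] assms(1) 2 by (auto simp: doubleton_eq_iff)
  next
    case 3
    show ?thesis
      using that[OF step[of "i - 1"] step[of i]] 3 by (auto simp: doubleton_eq_iff)
  qed
qed

theorem theorem1:
  fixes n :: nat and H :: "'a hypergraph"
  assumes "n \<ge> 24" and "even n"
    and "is_hypergraph H" and "uniform 6 H"
    and "hypergraph_iso (EI H) (cycle_hypergraph n)"
  shows "real (card (hyperedges H)) \<ge> real n / 2"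
proof -
  obtain f where bij: "bij_betw f (verts H) {1..n}"
    and edges: "(\<lambda>e. f ` e) ` hyperedges (EI H) = hyperedges (cycle_hypergraph n)"
    using assms(5) by (auto simp: hypergraph_iso_def EI_def cycle_hypergraph_def)
  have "3 \<le> card {e \<in> hyperedges H. v \<in> e}" if v: "v \<in> verts H" for v
  proof -
    have "f v \<in> {1..n}"
      using bij v by (auto simp: bij_betw_def)
    then obtain h1 h2 where h: "h1 \<in> hyperedges (cycle_hypergraph n)"
      "h2 \<in> hyperedges (cycle_hypergraph n)" "h1 \<noteq> h2" "f v \<in> h1" "f v \<in> h2"
      using cycle_two_edges_at_vertex[of n "f v"] assms(1) by auto
    obtain g1 g2 where g: "g1 \<in> hyperedges (EI H)" "h1 = f ` g1"
      "g2 \<in> hyperedges (EI H)" "h2 = f ` g2"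
      using h(1,2) unfolding edges[symmetric] by blast
    have pullback: "v \<in> g" if "g \<in> hyperedges (EI H)" "f v \<in> f ` g" for g
      using inj_on_image_mem_iff[OF bij_betw_imp_inj_on[OF bij] v] that
        EI_hyperedge_subset_verts[OF assms(3)] by blast
    show ?thesis
      using three_hyperedges_through_vertex[OF finite_hyperedges[OF assms(3)] g(1,3)]
        pullback g h by blast
  qed
  then have "3 * card (verts H) \<le> 6 * card (hyperedges H)"
    by (rule uniform_degree_bound[OF assms(3,4)])
  moreover have "card (verts H) = n"
    using bij_betw_same_card[OF bij] by simp
  ultimately show ?thesis
    by simp
qed

end
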